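(* For every pair of integers $t,k\in\mathbb{N}$ there exists $N\in\mathbb{N}$ such that every graph that excludes $P_t$, $\overline{P_t}$, and $R_k$ as induced subgraphs admits a cosplit of size at most $N$ and height at most $4k$.
   Context: $P_t$ is the path on $t$ vertices and $\overline{P_t}$ its complement. The universal threshold graph $R_k$ has vertices $a_1,\dots,a_k,b_1,\dots,b_k$, with edges $a_ib_j$ for all $1\le i\le j\le k$, the $a_i$'s forming a clique, the $b_i$'s an independent set, and no other edges. A cotree of height at most $h$ is a triple $(T,c,f)$ with $T$ a rooted tree of height at most $h$ (max number of edges on a root-to-leaf path), $c$ the constant map from leaves to $\{1\}$, and $f:I(T)\times\{1\}\times\{1\}\to\{0,1\}$ on internal vertices; it defines the graph on the leaves where distinct leaves $u,v$ are adjacent iff $f(u\wedge v,1,1)=1$, $u\wedge v$ being their lowest common ancestor. A cograph of height at most $h$ is a graph defined by a cotree of height at most $h$. A cosplit of a graph $G$ is a partition $\mathscr{P}$ of $V(G)$ such that $G[A]$ is a cograph for every $A\in\mathscr{P}$; its size is $|\mathscr{P}|$ and it has height at most $h$ if every $G[A]$, $A\in\mathscr{P}$, is a cograph of height at most $h$. *)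

theory Defs
  imports
    "Graph_Theory.Graph_Theory"
    "HOL-Library.Sublist"
    "HOL-Library.FuncSet"
    "HOL-Library.Disjoint_Sets"
begin

text \<open>
  A finite simple graph is a \<^locale>\<open>pair_graph\<close>: finite, loop-free, and with a symmetric arc
  relation, so that the edge \<open>uv\<close> is the pair of arcs \<open>(u,v)\<close>, \<open>(v,u)\<close>.
\<close>

definition complement_graph :: "'a pair_pre_digraph \<Rightarrow> 'a pair_pre_digraph" where
  "complement_graph G =
     \<lparr> pverts = pverts G,
       parcs = {(u, v). u \<in> pverts G \<and> v \<in> pverts G \<and> u \<noteq> v \<and> (u, v) \<notin> parcs G} \<rparr>"

definition path_graph :: "nat \<Rightarrow> nat pair_pre_digraph" where
  "path_graph t =
     \<lparr> pverts = {1..t},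
       parcs = {(u, v). u \<in> {1..t} \<and> v \<in> {1..t} \<and> (v = Suc u \<or> u = Suc v)} \<rparr>"

text \<open>The vertex \<open>a\<^sub>i\<close> is \<open>Inl i\<close> and the vertex \<open>b\<^sub>i\<close> is \<open>Inr i\<close>.\<close>

definition universal_threshold_graph :: "nat \<Rightarrow> (nat + nat) pair_pre_digraph" where
  "universal_threshold_graph k =
     \<lparr> pverts = Inl ` {1..k} \<union> Inr ` {1..k},
       parcs = {(Inl i, Inl j) | i j. i \<in> {1..k} \<and> j \<in> {1..k} \<and> i \<noteq> j}
             \<union> {(Inl i, Inr j) | i j. 1 \<le> i \<and> i \<le> j \<and> j \<le> k}
             \<union> {(Inr j, Inl i) | i j. 1 \<le> i \<and> i \<le> j \<and> j \<le> k} \<rparr>"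

definition excludes_induced :: "'a pair_pre_digraph \<Rightarrow> 'b pair_pre_digraph \<Rightarrow> bool" where
  "excludes_induced G H \<longleftrightarrow>
     \<not> (\<exists>S \<subseteq> pverts G. digraph_iso (with_proj H) (with_proj G \<restriction> S))"


text \<open>
  Finite rooted trees are represented as tree domains: a node is the sequence of child labels
  read along the path from the root \<open>[]\<close> to it, and the ancestors of a node are its prefixes.
  Hence the depth of a node is its length and the lowest common ancestor of two nodes is their
  longest common prefix. A node may have a single child, and in the one-node tree the root is
  a leaf.
\<close>

definition rooted_tree :: "nat list set \<Rightarrow> bool" where
  "rooted_tree T \<longleftrightarrow> finite T \<and> T \<noteq> {} \<and> (\<forall>x\<in>T. \<forall>y. prefix y x \<longrightarrow> y \<in> T)"

definition internal_nodes :: "nat list set \<Rightarrow> nat list set" where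
  "internal_nodes T = {x \<in> T. \<exists>y\<in>T. strict_prefix x y}"

definition leaves :: "nat list set \<Rightarrow> nat list set" where
  "leaves T = T - internal_nodes T"

definition tree_height :: "nat list set \<Rightarrow> nat" where
  "tree_height T = Max (length ` leaves T)"

definition cotree ::
  "nat list set \<Rightarrow> (nat list \<Rightarrow> nat) \<Rightarrow> (nat list \<times> nat \<times> nat \<Rightarrow> nat) \<Rightarrow> bool" where
  "cotree T c f \<longleftrightarrow>
     rooted_tree T \<and>
     c \<in> leaves T \<rightarrow> {1} \<and>
     f \<in> internal_nodes T \<times> {1} \<times> {1} \<rightarrow> {0, 1}"

definition cotree_graph ::
  "nat list set \<Rightarrow> (nat list \<Rightarrow> nat) \<Rightarrow> (nat list \<times> nat \<times> nat \<Rightarrow> nat) \<Rightarrow>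
   nat list pair_pre_digraph" where
  "cotree_graph T c f =
     \<lparr> pverts = leaves T,
       parcs = {(u, v). u \<in> leaves T \<and> v \<in> leaves T \<and> u \<noteq> v \<and>
                        f (longest_common_prefix u v, c u, c v) = 1} \<rparr>"

definition cograph_of_height_at_most :: "nat \<Rightarrow> ('a, 'b) pre_digraph \<Rightarrow> bool" where
  "cograph_of_height_at_most h G \<longleftrightarrow>
     (\<exists>T c f. cotree T c f \<and> tree_height T \<le> h \<and>
              digraph_iso (with_proj (cotree_graph T c f)) G)"

definition cograph :: "('a, 'b) pre_digraph \<Rightarrow> bool" where
  "cograph G \<longleftrightarrow> (\<exists>h. cograph_of_height_at_most h G)"

definition cosplit :: "'a pair_pre_digraph \<Rightarrow> 'a set set \<Rightarrow> bool" where
  "cosplit G P \<longleftrightarrow>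
     partition_on (pverts G) P \<and> (\<forall>A\<in>P. cograph (with_proj G \<restriction> A))"

definition cosplit_height_at_most :: "nat \<Rightarrow> 'a pair_pre_digraph \<Rightarrow> 'a set set \<Rightarrow> bool" where
  "cosplit_height_at_most h G P \<longleftrightarrow>
     (\<forall>A\<in>P. cograph_of_height_at_most h (with_proj G \<restriction> A))"


subsection \<open>Sanity checks\<close>

lemma pair_graphI:
  assumes "finite (pverts G)" "parcs G \<subseteq> pverts G \<times> pverts G" "sym (parcs G)" "irrefl (parcs G)"
  shows "pair_graph G"
proof -
  have fin: "finite (parcs G)"
    using assms(1,2) by (meson finite_SigmaI finite_subset)
  show ?thesis
    using assms fin
    by unfold_locales (auto simp: symmetric_def irrefl_def)
qed

lemma pair_graph_complement_graph: "pair_graph G \<Longrightarrow> pair_graph (complement_graph G)"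
proof -
  assume "pair_graph G"
  then interpret pair_graph G .
  have "sym (parcs G)" using pair_sym_arcs by (simp add: symmetric_def)
  then show ?thesis
    by (intro pair_graphI) (auto simp: complement_graph_def sym_def irrefl_def pair_finite_verts)
qed

lemma pair_graph_path_graph: "pair_graph (path_graph t)"
  by (rule pair_graphI) (auto simp: path_graph_def sym_def irrefl_def)

lemma pair_graph_universal_threshold_graph: "pair_graph (universal_threshold_graph k)"
  by (rule pair_graphI) (auto simp: universal_threshold_graph_def sym_def irrefl_def)

lemma longest_common_prefix_commute:
  "longest_common_prefix u v = longest_common_prefix v u"
  by (induction u v rule: longest_common_prefix.induct) auto

lemma longest_common_prefix_internal:
  assumes "rooted_tree T" "u \<in> leaves T" "v \<in> leaves T" "u \<noteq> v"
  shows "longest_common_prefix u v \<in> internal_nodes T"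
proof -
  let ?w = "longest_common_prefix u v"
  have p: "prefix ?w u" "prefix ?w v"
    by (rule longest_common_prefix_prefix1 longest_common_prefix_prefix2)+
  have uv: "u \<in> T" "v \<in> T" using assms by (auto simp: leaves_def)
  have "?w \<in> T" using assms(1) p uv by (auto simp: rooted_tree_def)
  moreover have "strict_prefix ?w u \<or> strict_prefix ?w v"
    using p assms(4) by (metis prefix_order.le_less)
  ultimately show ?thesis using uv by (auto simp: internal_nodes_def)
qed

lemma leaves_nonempty:
  assumes "rooted_tree T"
  shows "leaves T \<noteq> {}"
proof -
  have "finite T" "T \<noteq> {}" using assms by (auto simp: rooted_tree_def)
  then have "Max (length ` T) \<in> length ` T" by (intro Max_in) auto
  then obtain x where "x \<in> T" and max: "Max (length ` T) = length x" by blast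
  with \<open>finite T\<close> have x: "x \<in> T" "\<forall>y\<in>T. length y \<le> length x"
    by (auto simp flip: max)
  then have "x \<notin> internal_nodes T"
    by (auto simp: internal_nodes_def dest: prefix_length_less leD)
  with x show ?thesis by (auto simp: leaves_def)
qed

lemma pair_graph_cotree_graph:
  assumes "cotree T c f"
  shows "pair_graph (cotree_graph T c f)"
proof (rule pair_graphI)
  have "f (longest_common_prefix u v, c u, c v) = f (longest_common_prefix v u, c v, c u)"
    if "u \<in> leaves T" "v \<in> leaves T" for u v
  proof -
    have "c u = 1" "c v = 1" using assms that by (auto simp: cotree_def Pi_iff)
    then show ?thesis by (simp add: longest_common_prefix_commute)
  qed
  then show "sym (parcs (cotree_graph T c f))"
    by (auto simp: cotree_graph_def sym_def)
qed (use assms in \<open>auto simp: cotree_graph_def cotree_def rooted_tree_def leaves_def irrefl_def\<close>)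

text \<open>\<^const>\<open>digraph_iso\<close>, specialised to graphs given by vertex and arc relations.\<close>

lemma digraph_iso_with_proj_iff:
  assumes "parcs H \<subseteq> pverts H \<times> pverts H" "parcs K \<subseteq> pverts K \<times> pverts K"
  shows "digraph_iso (with_proj H) (with_proj K) \<longleftrightarrow>
     (\<exists>f. bij_betw f (pverts H) (pverts K) \<and>
          (\<forall>u\<in>pverts H. \<forall>v\<in>pverts H. (u, v) \<in> parcs H \<longleftrightarrow> (f u, f v) \<in> parcs K))"
    (is "?L \<longleftrightarrow> ?R")
proof
  assume ?L
  then obtain g where g: "pre_digraph.digraph_isomorphism (with_proj H) g"
    "with_proj K = app_iso g (with_proj H)"
    by (auto simp: digraph_iso_def)
  have V: "pverts K = iso_verts g ` pverts H" and A: "parcs K = iso_arcs g ` parcs H"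
    and ht: "iso_tail g = fst" "iso_head g = snd"
    using g(2) by (auto simp: with_proj_def app_iso_def)
  have inj: "inj_on (iso_verts g) (pverts H)"
    and e: "\<And>a. a \<in> parcs H \<Longrightarrow> iso_arcs g a = (iso_verts g (fst a), iso_verts g (snd a))"
    using g(1) by (auto simp: pre_digraph.digraph_isomorphism_def ht prod_eq_iff)
  show ?R
  proof (intro exI[of _ "iso_verts g"] conjI ballI)
    show "bij_betw (iso_verts g) (pverts H) (pverts K)"
      using inj V by (simp add: bij_betw_def)
    fix u v assume uv: "u \<in> pverts H" "v \<in> pverts H"
    show "(u, v) \<in> parcs H \<longleftrightarrow> (iso_verts g u, iso_verts g v) \<in> parcs K"
    proof
      assume "(u, v) \<in> parcs H"
      then show "(iso_verts g u, iso_verts g v) \<in> parcs K"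
        using e[of "(u, v)"] A by (metis fst_conv snd_conv image_eqI)
    next
      assume "(iso_verts g u, iso_verts g v) \<in> parcs K"
      then obtain x y where xy: "(x, y) \<in> parcs H"
        "iso_verts g u = iso_verts g x" "iso_verts g v = iso_verts g y"
        using A e by fastforce
      with assms(1) inj uv show "(u, v) \<in> parcs H"
        by (metis inj_onD mem_Sigma_iff subsetD)
    qed
  qed
next
  assume ?R
  then obtain f where f: "bij_betw f (pverts H) (pverts K)"
    "\<And>u v. u \<in> pverts H \<Longrightarrow> v \<in> pverts H \<Longrightarrow> (u, v) \<in> parcs H \<longleftrightarrow> (f u, f v) \<in> parcs K"
    by blast
  define g where "g = \<lparr>iso_verts = f, iso_arcs = map_prod f f, iso_head = snd, iso_tail = fst\<rparr>"
  have inj: "inj_on f (pverts H)" and im: "f ` pverts H = pverts K"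
    using f(1) by (auto simp: bij_betw_def)
  have "inj_on (map_prod f f) (parcs H)"
    using map_prod_inj_on[OF inj inj] assms(1) by (rule inj_on_subset)
  moreover have "wf_digraph (with_proj H)"
    using assms(1) by unfold_locales auto
  ultimately have "pre_digraph.digraph_isomorphism (with_proj H) g"
    using inj by (auto simp: pre_digraph.digraph_isomorphism_def g_def)
  moreover have "map_prod f f ` parcs H = parcs K"
  proof
    show "map_prod f f ` parcs H \<subseteq> parcs K" using f(2) assms(1) by auto
    show "parcs K \<subseteq> map_prod f f ` parcs H"
    proof
      fix a assume a: "a \<in> parcs K"
      then obtain x y where "a = (f x, f y)" "x \<in> pverts H" "y \<in> pverts H"
        using assms(2) im by (cases a) blast
      then show "a \<in> map_prod f f ` parcs H" using f(2) a by force
    qed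
  qed
  ultimately show ?L
    unfolding digraph_iso_def
    by (intro exI[of _ g]) (auto simp: with_proj_def app_iso_def g_def im)
qed

lemma induce_subgraph_with_proj:
  "with_proj G \<restriction> S = with_proj \<lparr> pverts = S, parcs = parcs G \<inter> S \<times> S \<rparr>"
  by (auto simp: induce_subgraph_def with_proj_def)

lemma excludes_induced_iff:
  assumes "pair_graph H"
  shows "excludes_induced G H \<longleftrightarrow>
     \<not> (\<exists>f. inj_on f (pverts H) \<and> f ` pverts H \<subseteq> pverts G \<and>
          (\<forall>u\<in>pverts H. \<forall>v\<in>pverts H. (u, v) \<in> parcs H \<longleftrightarrow> (f u, f v) \<in> parcs G))"
proof -
  interpret pair_graph H by fact
  have H: "parcs H \<subseteq> pverts H \<times> pverts H" by (auto dest: in_arcsD1 in_arcsD2)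
  have iso: "digraph_iso (with_proj H) (with_proj G \<restriction> S) \<longleftrightarrow>
     (\<exists>f. bij_betw f (pverts H) S \<and>
          (\<forall>u\<in>pverts H. \<forall>v\<in>pverts H. (u, v) \<in> parcs H \<longleftrightarrow> (f u, f v) \<in> parcs G \<inter> S \<times> S))" for S
    unfolding induce_subgraph_with_proj by (subst digraph_iso_with_proj_iff[OF H]) auto
  show ?thesis
    unfolding excludes_induced_def iso
  proof (intro arg_cong[where f = Not] iffI)
    assume "\<exists>S\<subseteq>pverts G. \<exists>f. bij_betw f (pverts H) S \<and>
      (\<forall>u\<in>pverts H. \<forall>v\<in>pverts H. (u, v) \<in> parcs H \<longleftrightarrow> (f u, f v) \<in> parcs G \<inter> S \<times> S)"
    then obtain S f where S: "S \<subseteq> pverts G" "inj_on f (pverts H)" "f ` pverts H = S"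
      and f: "\<And>u v. u \<in> pverts H \<Longrightarrow> v \<in> pverts H \<Longrightarrow>
                (u, v) \<in> parcs H \<longleftrightarrow> (f u, f v) \<in> parcs G \<inter> S \<times> S"
      unfolding bij_betw_def by blast
    have "(u, v) \<in> parcs H \<longleftrightarrow> (f u, f v) \<in> parcs G" if "u \<in> pverts H" "v \<in> pverts H" for u v
      using f[OF that] that S(3) by blast
    with S show "\<exists>f. inj_on f (pverts H) \<and> f ` pverts H \<subseteq> pverts G \<and>
      (\<forall>u\<in>pverts H. \<forall>v\<in>pverts H. (u, v) \<in> parcs H \<longleftrightarrow> (f u, f v) \<in> parcs G)"
      by blast
  next
    assume "\<exists>f. inj_on f (pverts H) \<and> f ` pverts H \<subseteq> pverts G \<and>
      (\<forall>u\<in>pverts H. \<forall>v\<in>pverts H. (u, v) \<in> parcs H \<longleftrightarrow> (f u, f v) \<in> parcs G)"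
    then obtain f where "inj_on f (pverts H)" "f ` pverts H \<subseteq> pverts G"
      "\<forall>u\<in>pverts H. \<forall>v\<in>pverts H. (u, v) \<in> parcs H \<longleftrightarrow> (f u, f v) \<in> parcs G"
      by blast
    then show "\<exists>S\<subseteq>pverts G. \<exists>f. bij_betw f (pverts H) S \<and>
      (\<forall>u\<in>pverts H. \<forall>v\<in>pverts H. (u, v) \<in> parcs H \<longleftrightarrow> (f u, f v) \<in> parcs G \<inter> S \<times> S)"
      by (intro exI[of _ "f ` pverts H"] conjI exI[of _ f]) (auto simp: bij_betw_def)
  qed
qed

end

theory Submission
  imports Defs
begin

text \<open>
  \<open>R\<^sub>k\<close> is built from the empty graph by adding \<open>2k\<close> vertices, alternately isolated and dominating,
  the last one dominating. Hence if \<open>G\<close> excludes the \<open>m\<close>-step graph of this kind, the neighbourhood of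
  each vertex excludes the complement of the \<open>(m-1)\<close>-step graph, and by induction on \<open>m\<close> (passing
  to complements) splits into boundedly many cographs of height \<open>m - 1\<close>. Disjoint unions of these form
  a hereditary class closed under disjoint union, so the argument of Gyarfas for colouring graphs
  without long induced paths applies to partitions into members of this class: if too many parts
  are needed, an induced path can be prolonged greedily. Each step costs one unit of height,
  so even height \<open>2k\<close> is enough.
\<close>

section \<open>Graphs as relations, and their complements\<close>

text \<open>From here on a graph is mostly a relation on the whole type together with a vertex set:
  complementing changes only the relation, passing to an induced subgraph only the set.\<close>

definition compl_rel :: "('a \<Rightarrow> 'a \<Rightarrow> bool) \<Rightarrow> 'a \<Rightarrow> 'a \<Rightarrow> bool" where
  "compl_rel E x y \<longleftrightarrow> x \<noteq> y \<and> \<not> E x y"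

lemma symp_compl_rel: "symp E \<Longrightarrow> symp (compl_rel E)"
  by (auto simp: compl_rel_def symp_def)

lemma irreflp_compl_rel: "irreflp (compl_rel E)"
  by (auto simp: compl_rel_def irreflp_def)

lemma pair_graph_rel:
  assumes "pair_graph G"
  shows "symp (\<lambda>x y. (x, y) \<in> parcs G)" "irreflp (\<lambda>x y. (x, y) \<in> parcs G)"
proof -
  interpret pair_graph G by fact
  show "symp (\<lambda>x y. (x, y) \<in> parcs G)"
    using pair_sym_arcs by (auto simp: symp_def symmetric_def sym_def)
  show "irreflp (\<lambda>x y. (x, y) \<in> parcs G)"
    using no_loops by (fastforce simp: irreflp_def)
qed

lemma compl_rel_compl_rel: "irreflp E \<Longrightarrow> compl_rel (compl_rel E) = E"
  by (auto simp: compl_rel_def irreflp_def fun_eq_iff)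


subsection \<open>Cographs of bounded height\<close>

text \<open>
  The levels of the cotree alternate between disjoint union (at the root) and join;
  \<open>p\<close> names the child of the root containing a vertex.
\<close>

fun alternating_cograph :: "nat \<Rightarrow> ('a \<Rightarrow> 'a \<Rightarrow> bool) \<Rightarrow> 'a set \<Rightarrow> bool" where
  "alternating_cograph 0 E S \<longleftrightarrow> (\<forall>x\<in>S. \<forall>y\<in>S. x = y)"
| "alternating_cograph (Suc h) E S \<longleftrightarrow>
     (\<exists>p :: 'a \<Rightarrow> nat. (\<forall>x\<in>S. \<forall>y\<in>S. p x \<noteq> p y \<longrightarrow> \<not> E x y) \<and>
        (\<forall>i. alternating_cograph h (compl_rel E) {x \<in> S. p x = i}))"

lemma alternating_cograph_subset:
  "alternating_cograph h E S \<Longrightarrow> S' \<subseteq> S \<Longrightarrow> alternating_cograph h E S'"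
proof (induction h arbitrary: E S S')
  case 0
  then show ?case by (auto simp: subset_iff)
next
  case (Suc h)
  then obtain p :: "'a \<Rightarrow> nat" where p: "\<forall>x\<in>S. \<forall>y\<in>S. p x \<noteq> p y \<longrightarrow> \<not> E x y"
    "\<And>i. alternating_cograph h (compl_rel E) {x \<in> S. p x = i}" by auto
  have "alternating_cograph h (compl_rel E) {x \<in> S'. p x = i}" for i
    by (rule Suc.IH[OF p(2)[of i]]) (use Suc.prems in auto)
  with p(1) Suc.prems(2) show ?case by (auto intro!: exI[of _ p])
qed

text \<open>The root gets a single child, so its union level is trivial and the levels below are
  read in the complement.\<close>

lemma alternating_cograph_Suc_compl:
  assumes "alternating_cograph h (compl_rel E) S"
  shows "alternating_cograph (Suc h) E S"
  using assms by (auto intro!: exI[of _ "\<lambda>_. 0"] intro: alternating_cograph_subset)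

lemma alternating_cograph_singleton: "alternating_cograph h E {v}"
proof (induction h arbitrary: E)
  case (Suc h)
  then show ?case by (intro alternating_cograph_Suc_compl)
qed simp

text \<open>The two roots are merged; even labels name the children from \<open>A\<close>, odd ones
  those from \<open>B\<close>. Height 0 is excluded because a one-node tree has no room for a
  union.\<close>

lemma alternating_cograph_disjoint_union:
  assumes "alternating_cograph (Suc h) E A" "alternating_cograph (Suc h) E B"
    "symp E" "\<And>x y. x \<in> A \<Longrightarrow> y \<in> B \<Longrightarrow> \<not> E x y" "A \<inter> B = {}"
  shows "alternating_cograph (Suc h) E (A \<union> B)"
proof -
  obtain p :: "'a \<Rightarrow> nat" where p: "\<forall>x\<in>A. \<forall>y\<in>A. p x \<noteq> p y \<longrightarrow> \<not> E x y"
    "\<And>i. alternating_cograph h (compl_rel E) {x \<in> A. p x = i}" using assms(1) by auto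
  obtain q :: "'a \<Rightarrow> nat" where q: "\<forall>x\<in>B. \<forall>y\<in>B. q x \<noteq> q y \<longrightarrow> \<not> E x y"
    "\<And>i. alternating_cograph h (compl_rel E) {x \<in> B. q x = i}" using assms(2) by auto
  define r where "r x = (if x \<in> A then 2 * p x else 2 * q x + 1)" for x
  have "\<not> E x y" if "x \<in> A \<union> B" "y \<in> A \<union> B" "r x \<noteq> r y" for x y
    using that p(1) q(1) assms(3,4)
    by (auto simp: r_def split: if_splits dest: sympD)
  moreover have "alternating_cograph h (compl_rel E) {x \<in> A \<union> B. r x = i}" for i
  proof (cases "even i")
    case True
    then have "{x \<in> A \<union> B. r x = i} \<subseteq> {x \<in> A. p x = i div 2}"
      by (auto simp: r_def) presburger
    then show ?thesis using p(2) alternating_cograph_subset by blast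
  next
    case False
    then have "{x \<in> A \<union> B. r x = i} \<subseteq> {x \<in> B. q x = i div 2}"
      by (auto simp: r_def)
    then show ?thesis using q(2) alternating_cograph_subset by blast
  qed
  ultimately show ?thesis by auto
qed

text \<open>The address of a vertex is the corresponding leaf of the cotree.\<close>

lemma alternating_cograph_addresses:
  assumes "alternating_cograph h E S"
  shows "\<exists>a :: 'a \<Rightarrow> nat list. inj_on a S \<and> (\<forall>x\<in>S. length (a x) = h) \<and>
     (\<forall>x\<in>S. \<forall>y\<in>S. x \<noteq> y \<longrightarrow> (E x y \<longleftrightarrow> odd (length (longest_common_prefix (a x) (a y)))))"
  using assms
proof (induction h arbitrary: E S)
  case 0
  then show ?case by (auto intro!: exI[of _ "\<lambda>_. []"] inj_onI)
next
  case (Suc h)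
  then obtain p :: "'a \<Rightarrow> nat" where p: "\<forall>x\<in>S. \<forall>y\<in>S. p x \<noteq> p y \<longrightarrow> \<not> E x y"
    "\<And>i. alternating_cograph h (compl_rel E) {x \<in> S. p x = i}" by auto
  let ?S = "\<lambda>i. {x \<in> S. p x = i}"
  have "\<forall>i. \<exists>a :: 'a \<Rightarrow> nat list. inj_on a (?S i) \<and> (\<forall>x\<in>?S i. length (a x) = h) \<and>
     (\<forall>x\<in>?S i. \<forall>y\<in>?S i. x \<noteq> y \<longrightarrow>
        (compl_rel E x y \<longleftrightarrow> odd (length (longest_common_prefix (a x) (a y)))))"
    using Suc.IH[OF p(2)] by blast
  from choice[OF this] obtain a :: "nat \<Rightarrow> 'a \<Rightarrow> nat list" where a:
    "\<forall>i. inj_on (a i) (?S i) \<and> (\<forall>x\<in>?S i. length (a i x) = h) \<and>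
     (\<forall>x\<in>?S i. \<forall>y\<in>?S i. x \<noteq> y \<longrightarrow>
        (compl_rel E x y \<longleftrightarrow> odd (length (longest_common_prefix (a i x) (a i y)))))" ..
  have inj: "inj_on (a i) (?S i)" for i
    using a by (elim allE conjE)
  have len: "length (a i x) = h" if "x \<in> ?S i" for i x
    using conjunct1[OF conjunct2[OF spec[OF a]]] that by (rule bspec)
  have lcp: "compl_rel E x y \<longleftrightarrow> odd (length (longest_common_prefix (a i x) (a i y)))"
    if "x \<in> ?S i" "y \<in> ?S i" "x \<noteq> y" for i x y
    using bspec[OF bspec[OF conjunct2[OF conjunct2[OF spec[OF a]]] that(1)] that(2)] that(3) ..
  \<comment> \<open>Within a part the new label lengthens common prefixes by one, and this change of
    parity undoes the complement. Across parts the common prefix is empty, hence of even length,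
    which matches the missing edge.\<close>
  let ?b = "\<lambda>x. p x # a (p x) x"
  have "inj_on ?b S"
    using inj by (auto simp: inj_on_def)
  moreover have "\<forall>x\<in>S. length (?b x) = Suc h"
    using len by auto
  moreover have "E x y \<longleftrightarrow> odd (length (longest_common_prefix (?b x) (?b y)))"
    if "x \<in> S" "y \<in> S" "x \<noteq> y" for x y
  proof (cases "p x = p y")
    case True
    then show ?thesis using lcp[of x "p x" y] that by (auto simp: compl_rel_def)
  next
    case False
    then show ?thesis using p(1) that by auto
  qed
  ultimately show ?case by (intro exI[of _ ?b]) blast
qed

text \<open>The cotree consists of all prefixes of the addresses, with value 1 at odd depth.
  \<open>S\<close> must be nonempty because a tree has a root.\<close>

lemma cograph_of_height_at_mostI:
  assumes "alternating_cograph h (\<lambda>x y. (x, y) \<in> parcs G) S" "pair_graph G" "finite S" "S \<noteq> {}"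
    and "h \<le> h'"
  shows "cograph_of_height_at_most h' (with_proj G \<restriction> S)"
proof -
  have irr: "(x, x) \<notin> parcs G" for x
    using pair_graph_rel(2)[OF assms(2)] by (rule irreflpD)
  obtain a :: "'a \<Rightarrow> nat list" where a: "inj_on a S" "\<And>x. x \<in> S \<Longrightarrow> length (a x) = h"
    "\<And>x y. x \<in> S \<Longrightarrow> y \<in> S \<Longrightarrow> x \<noteq> y \<Longrightarrow>
       ((x, y) \<in> parcs G \<longleftrightarrow> odd (length (longest_common_prefix (a x) (a y))))"
    using alternating_cograph_addresses[OF assms(1)] by blast
  define T where "T = {w. \<exists>x\<in>S. prefix w (a x)}"
  define f :: "nat list \<times> nat \<times> nat \<Rightarrow> nat" where
    "f = (\<lambda>(w, _, _). if odd (length w) then 1 else 0)"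
  define c :: "nat list \<Rightarrow> nat" where "c = (\<lambda>_. 1)"
  have "T = (\<Union>x\<in>S. set (prefixes (a x)))" by (auto simp: T_def in_set_prefixes)
  then have "finite T" using assms(3) by simp
  then have tree: "rooted_tree T"
    using assms(4) by (auto simp: rooted_tree_def T_def intro: prefix_order.trans)
  have leaves: "leaves T = a ` S"
  proof
    show "leaves T \<subseteq> a ` S"
      by (auto simp: leaves_def internal_nodes_def T_def) (metis prefix_order.le_less prefix_order.refl image_eqI)
    show "a ` S \<subseteq> leaves T"
    proof
      fix w assume "w \<in> a ` S"
      then obtain x where x: "x \<in> S" "w = a x" by blast
      \<comment> \<open>Addresses all have length \<open>h\<close>, so none properly extends
        another.\<close>
      have "\<not> strict_prefix w u" if "u \<in> T" for u
      proof
        assume "strict_prefix w u"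
        moreover obtain y where "y \<in> S" "prefix u (a y)" using \<open>u \<in> T\<close> by (auto simp: T_def)
        ultimately have "length w < length (a y)"
          by (meson prefix_length_less prefix_order.less_le_trans)
        then show False using a(2) x \<open>y \<in> S\<close> by simp
      qed
      then show "w \<in> leaves T" using x by (auto simp: leaves_def internal_nodes_def T_def)
    qed
  qed
  have "length ` a ` S = {h}" using a(2) assms(4) by force
  then have "tree_height T = h" by (simp add: tree_height_def leaves)
  moreover have "cotree T c f" using tree by (auto simp: cotree_def c_def f_def)
  moreover have "digraph_iso (with_proj (cotree_graph T c f)) (with_proj G \<restriction> S)"
    unfolding induce_subgraph_with_proj
  proof (subst digraph_iso_with_proj_iff)
    let ?K = "\<lparr>pverts = S, parcs = parcs G \<inter> S \<times> S\<rparr>" and ?g = "the_inv_into S a"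
    have bij: "bij_betw ?g (a ` S) S"
      using a(1) by (intro bij_betw_the_inv_into) (simp add: bij_betw_def)
    have "(u, v) \<in> parcs (cotree_graph T c f) \<longleftrightarrow> (?g u, ?g v) \<in> parcs ?K"
      if uv: "u \<in> a ` S" "v \<in> a ` S" for u v
    proof -
      obtain x y where xy: "x \<in> S" "y \<in> S" "u = a x" "v = a y" using uv by blast
      have "?g u = x" "?g v = y" using xy a(1) by (simp_all add: the_inv_into_f_f)
      moreover have "(u, v) \<in> parcs (cotree_graph T c f) \<longleftrightarrow> (x, y) \<in> parcs G"
        using a(3)[of x y] xy a(1) irr
        by (cases "x = y") (auto simp: cotree_graph_def leaves f_def inj_on_eq_iff)
      ultimately show ?thesis using xy by simp
    qed
    with bij show "\<exists>g. bij_betw g (pverts (cotree_graph T c f)) (pverts ?K) \<and>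
        (\<forall>u\<in>pverts (cotree_graph T c f). \<forall>v\<in>pverts (cotree_graph T c f).
          (u, v) \<in> parcs (cotree_graph T c f) \<longleftrightarrow> (g u, g v) \<in> parcs ?K)"
      by (intro exI[of _ ?g]) (auto simp: cotree_graph_def leaves)
  qed (auto simp: cotree_graph_def)
  ultimately show ?thesis using assms(5) unfolding cograph_of_height_at_most_def by blast
qed


subsection \<open>Induced paths\<close>

text \<open>Adjacency is tested only from earlier to later entries, which describes an induced path
  when \<open>E\<close> is symmetric and irreflexive. The recursion fits paths that are built from
  the front.\<close>

fun induced_path :: "('a \<Rightarrow> 'a \<Rightarrow> bool) \<Rightarrow> 'a list \<Rightarrow> bool" where
  "induced_path E [] \<longleftrightarrow> True"
| "induced_path E [x] \<longleftrightarrow> True"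
| "induced_path E (x # y # zs) \<longleftrightarrow> E x y \<and> x \<notin> set (y # zs) \<and> (\<forall>z\<in>set zs. \<not> E x z) \<and>
     induced_path E (y # zs)"

lemma induced_path_distinct: "induced_path E xs \<Longrightarrow> distinct xs"
  by (induction E xs rule: induced_path.induct) auto

lemma induced_path_nth:
  assumes "induced_path E xs" "i < j" "j < length xs"
  shows "E (xs ! i) (xs ! j) \<longleftrightarrow> j = Suc i"
  using assms
proof (induction E xs arbitrary: i j rule: induced_path.induct)
  case (3 E x y zs)
  show ?case
  proof (cases i)
    case 0
    then obtain j' where "j = Suc j'" using 3 by (cases j) auto
    with 0 3 show ?thesis by (cases j') auto
  next
    case (Suc i')
    then obtain j' where "j = Suc j'" using 3 by (cases j) auto
    with Suc 3 show ?thesis by auto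
  qed
qed auto

text \<open>With \<open>\<le>\<close>, the path on \<open>t + 1\<close> vertices from the greedy
  construction can be used as it is; cutting it to \<open>t\<close> vertices is left to
  \<open>path_graph_embedding\<close>.\<close>

definition long_path_free :: "nat \<Rightarrow> ('a \<Rightarrow> 'a \<Rightarrow> bool) \<Rightarrow> 'a set \<Rightarrow> bool" where
  "long_path_free t E S \<longleftrightarrow> \<not> (\<exists>xs. induced_path E xs \<and> t \<le> length xs \<and> set xs \<subseteq> S)"

lemma long_path_free_subset: "long_path_free t E S \<Longrightarrow> S' \<subseteq> S \<Longrightarrow> long_path_free t E S'"
  unfolding long_path_free_def by blast

text \<open>The first \<open>t\<close> entries of the list are used. The shift by one arises because
  \<open>path_graph\<close> numbers its vertices from 1 while lists count from 0.\<close>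

lemma path_graph_embedding:
  assumes "induced_path E xs" "t \<le> length xs" "symp E" "irreflp E"
  defines "f \<equiv> \<lambda>i. xs ! (i - 1)"
  shows "inj_on f {1..t}" "f ` {1..t} \<subseteq> set xs"
    "u \<in> {1..t} \<Longrightarrow> v \<in> {1..t} \<Longrightarrow> E (f u) (f v) \<longleftrightarrow> (u, v) \<in> parcs (path_graph t)"
proof -
  show "inj_on f {1..t}"
    using induced_path_distinct[OF assms(1)] assms(2)
    by (auto simp: inj_on_def f_def nth_eq_iff_index_eq)
  show "f ` {1..t} \<subseteq> set xs" using assms(2) by (auto simp: f_def)
  assume uv: "u \<in> {1..t}" "v \<in> {1..t}"
  consider "u < v" | "u = v" | "v < u" by linarith
  then show "E (f u) (f v) \<longleftrightarrow> (u, v) \<in> parcs (path_graph t)"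
  proof cases
    case 1
    then show ?thesis
      using induced_path_nth[OF assms(1), of "u - 1" "v - 1"] uv assms(2)
      by (auto simp: f_def path_graph_def)
  next
    case 2
    then show ?thesis using assms(4) by (auto simp: path_graph_def irreflp_def)
  next
    case 3
    have "E (f u) (f v) \<longleftrightarrow> E (f v) (f u)" using assms(3) by (auto dest: sympD)
    then show ?thesis
      using 3 induced_path_nth[OF assms(1), of "v - 1" "u - 1"] uv assms(2)
      by (auto simp: f_def path_graph_def)
  qed
qed

lemma long_path_free_if_excludes:
  assumes "pair_graph G" "excludes_induced G (path_graph t)"
  shows "long_path_free t (\<lambda>x y. (x, y) \<in> parcs G) (pverts G)"
proof (unfold long_path_free_def, safe)
  fix xs assume xs: "induced_path (\<lambda>x y. (x, y) \<in> parcs G) xs" "t \<le> length xs"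
    "set xs \<subseteq> pverts G"
  note f = path_graph_embedding[OF xs(1,2) pair_graph_rel[OF assms(1)]]
  have "pverts (path_graph t) = {1..t}" by (simp add: path_graph_def)
  then show False
    using assms(2) f subset_trans[OF f(2) xs(3)]
    unfolding excludes_induced_iff[OF pair_graph_path_graph] by metis
qed

text \<open>One map serves as both embeddings: complementing both graphs negates both adjacencies at
  distinct vertices, and at equal ones no graph has a loop.\<close>

lemma excludes_induced_complement:
  assumes "pair_graph G" "pair_graph H" "excludes_induced G (complement_graph H)"
  shows "excludes_induced (complement_graph G) H"
  unfolding excludes_induced_iff[OF assms(2)]
proof safe
  have irr: "(x, x) \<notin> parcs G" "(y, y) \<notin> parcs H" for x y
    using pair_graph_rel(2)[OF assms(1)] pair_graph_rel(2)[OF assms(2)]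
    by (auto dest: irreflpD)
  fix f assume f: "inj_on f (pverts H)" "f ` pverts H \<subseteq> pverts (complement_graph G)"
    "\<forall>u\<in>pverts H. \<forall>v\<in>pverts H. (u, v) \<in> parcs H \<longleftrightarrow> (f u, f v) \<in> parcs (complement_graph G)"
  have "(u, v) \<in> parcs (complement_graph H) \<longleftrightarrow> (f u, f v) \<in> parcs G"
    if "u \<in> pverts H" "v \<in> pverts H" for u v
    using f that irr
    by (cases "u = v") (auto simp: complement_graph_def inj_on_eq_iff image_subset_iff)
  then show False
    using assms(3) f
    unfolding excludes_induced_iff[OF pair_graph_complement_graph[OF assms(2)]]
    by (auto simp: complement_graph_def)
qed


subsection \<open>Partitions into members of a class closed under disjoint union\<close>

text \<open>Connectedness through cuts rather than walks: for symmetric \<open>E\<close> a failure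
  yields two sides without edges between them, and success yields the edge along which a path is
  prolonged.\<close>

definition connected_rel :: "('a \<Rightarrow> 'a \<Rightarrow> bool) \<Rightarrow> 'a set \<Rightarrow> bool" where
  "connected_rel E S \<longleftrightarrow>
     (\<forall>A\<subseteq>S. A \<noteq> {} \<longrightarrow> A \<noteq> S \<longrightarrow> (\<exists>x\<in>A. \<exists>y\<in>S - A. E x y))"

text \<open>A cut either splits \<open>C\<close> and is crossed there, or separates \<open>y\<close>
  from \<open>C\<close> and is crossed by the edge \<open>xy\<close> in one direction or the
  other.\<close>

lemma connected_rel_insert:
  assumes "connected_rel E C" "x \<in> C" "E x y" "symp E"
  shows "connected_rel E (insert y C)"
  unfolding connected_rel_def
proof (intro allI impI)
  fix A assume A: "A \<subseteq> insert y C" "A \<noteq> {}" "A \<noteq> insert y C"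
  consider "A \<inter> C = {}" | "C \<subseteq> A" | "A \<inter> C \<noteq> {}" "A \<inter> C \<noteq> C" by blast
  then show "\<exists>x\<in>A. \<exists>z\<in>insert y C - A. E x z"
  proof cases
    case 1
    then have "A = {y}" "y \<notin> C" using A by auto
    then show ?thesis using assms by (auto dest: sympD)
  next
    case 2
    then show ?thesis using A assms by auto
  next
    case 3
    then obtain u v where "u \<in> A \<inter> C" "v \<in> C - A \<inter> C" "E u v"
      using assms(1) unfolding connected_rel_def by (meson Int_lower2)
    then show ?thesis by blast
  qed
qed

section \<open>Generalised colourings\<close>

text \<open>For the class \<open>D\<close> of edgeless sets this is proper colouring with
  \<open>n\<close> colours. Letting \<open>i\<close> range over all numbers puts the empty set into
  \<open>D\<close>.\<close>

definition class_colourable :: "('a set \<Rightarrow> bool) \<Rightarrow> nat \<Rightarrow> 'a set \<Rightarrow> bool" where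
  "class_colourable D n S \<longleftrightarrow>
     (\<exists>c :: 'a \<Rightarrow> nat. (\<forall>x\<in>S. c x < n) \<and> (\<forall>i. D {x \<in> S. c x = i}))"

lemma class_colourable_mono:
  assumes "class_colourable D n S" "\<And>A. A \<subseteq> S \<Longrightarrow> D A \<Longrightarrow> D' A"
  shows "class_colourable D' n S"
proof -
  obtain c :: "'a \<Rightarrow> nat" where c: "\<forall>x\<in>S. c x < n" "\<And>i. D {x \<in> S. c x = i}"
    using assms(1) by (auto simp: class_colourable_def)
  have "D' {x \<in> S. c x = i}" for i
    by (rule assms(2)[OF _ c(2)]) auto
  with c(1) show ?thesis by (auto simp: class_colourable_def)
qed

text \<open>Edgeless sets have these properties, and the path argument for proper colourings uses
  nothing else about them, so it carries over to every such class.\<close>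

locale union_closed_class =
  fixes E :: "'a \<Rightarrow> 'a \<Rightarrow> bool" and D :: "'a set \<Rightarrow> bool"
  assumes symp: "symp E"
    and irreflp: "irreflp E"
    and hereditary: "D A \<Longrightarrow> B \<subseteq> A \<Longrightarrow> D B"
    and singleton: "D {v}"
    and disjoint_union:
      "D A \<Longrightarrow> D B \<Longrightarrow> A \<inter> B = {} \<Longrightarrow> (\<And>x y. x \<in> A \<Longrightarrow> y \<in> B \<Longrightarrow> \<not> E x y) \<Longrightarrow> D (A \<union> B)"
begin

abbreviation "colourable \<equiv> class_colourable D"

lemma colourable_empty: "colourable n {}"
  using hereditary[OF singleton, of "{}"] by (auto simp: class_colourable_def)

lemma colourable_subset:
  assumes "colourable n S" "S' \<subseteq> S"
  shows "colourable n S'"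
proof -
  obtain c :: "'a \<Rightarrow> nat" where c: "\<forall>x\<in>S. c x < n" "\<And>i. D {x \<in> S. c x = i}"
    using assms(1) by (auto simp: class_colourable_def)
  have "D {x \<in> S'. c x = i}" for i
    by (rule hereditary[OF c(2)[of i]]) (use assms in auto)
  with c(1) assms(2) show ?thesis by (auto simp: class_colourable_def)
qed

lemma colourable_singleton: "colourable 1 {v}"
  unfolding class_colourable_def
  by (intro exI[of _ "\<lambda>_. 0"]) (auto intro: hereditary[OF singleton])

lemma colourable_Un:
  assumes "colourable m A" "colourable n B"
  shows "colourable (m + n) (A \<union> B)"
proof -
  obtain c :: "'a \<Rightarrow> nat" where c: "\<forall>x\<in>A. c x < m" "\<And>i. D {x \<in> A. c x = i}"
    using assms(1) by (auto simp: class_colourable_def)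
  obtain d :: "'a \<Rightarrow> nat" where d: "\<forall>x\<in>B. d x < n" "\<And>i. D {x \<in> B. d x = i}"
    using assms(2) by (auto simp: class_colourable_def)
  define e where "e x = (if x \<in> A then c x else m + d x)" for x
  have "D {x \<in> A \<union> B. e x = i}" for i
  proof (cases "i < m")
    case True
    then have "{x \<in> A \<union> B. e x = i} \<subseteq> {x \<in> A. c x = i}" by (auto simp: e_def split: if_splits)
    then show ?thesis by (rule hereditary[OF c(2)])
  next
    case False
    then have "{x \<in> A \<union> B. e x = i} \<subseteq> {x \<in> B. d x = i - m}"
      using c(1) by (auto simp: e_def split: if_splits)
    then show ?thesis by (rule hereditary[OF d(2)])
  qed
  moreover have "\<forall>x\<in>A \<union> B. e x < m + n" using c(1) d(1) by (auto simp: e_def)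
  ultimately show ?thesis by (auto simp: class_colourable_def)
qed

text \<open>Both sides can share one palette, since each colour class is then a disjoint union of
  two members of \<open>D\<close>.\<close>

lemma colourable_disjoint_union:
  assumes "colourable n A" "colourable n B" "A \<inter> B = {}"
    and no_edge: "\<And>x y. x \<in> A \<Longrightarrow> y \<in> B \<Longrightarrow> \<not> E x y"
  shows "colourable n (A \<union> B)"
proof -
  obtain c :: "'a \<Rightarrow> nat" where c: "\<forall>x\<in>A. c x < n" "\<And>i. D {x \<in> A. c x = i}"
    using assms(1) by (auto simp: class_colourable_def)
  obtain d :: "'a \<Rightarrow> nat" where d: "\<forall>x\<in>B. d x < n" "\<And>i. D {x \<in> B. d x = i}"
    using assms(2) by (auto simp: class_colourable_def)
  define e where "e x = (if x \<in> A then c x else d x)" for x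
  have "D {x \<in> A \<union> B. e x = i}" for i
  proof -
    have "{x \<in> A \<union> B. e x = i} = {x \<in> A. c x = i} \<union> {x \<in> B. d x = i}"
      using assms(3) by (auto simp: e_def)
    moreover have "D ({x \<in> A. c x = i} \<union> {x \<in> B. d x = i})"
      using assms(3) no_edge by (intro disjoint_union c(2) d(2)) auto
    ultimately show ?thesis by simp
  qed
  moreover have "\<forall>x\<in>A \<union> B. e x < n" using c(1) d(1) by (auto simp: e_def)
  ultimately show ?thesis by (auto simp: class_colourable_def)
qed

text \<open>If \<open>S\<close> is disconnected, it falls into two sides without edges between them.
  They cannot both be colourable, and a non-colourable one is split further until it is
  connected.\<close>

lemma non_colourable_component:
  assumes "finite S" "\<not> colourable n S"
  shows "\<exists>C\<subseteq>S. connected_rel E C \<and> \<not> colourable n C \<and> (\<forall>x\<in>C. \<forall>y\<in>S - C. \<not> E x y)"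
  using assms
proof (induction S rule: finite_psubset_induct)
  case (psubset S)
  show ?case
  proof (cases "connected_rel E S")
    case True
    with psubset.prems show ?thesis by auto
  next
    case False
    then obtain A where A: "A \<subseteq> S" "A \<noteq> {}" "A \<noteq> S"
      and no_edge: "\<And>x y. x \<in> A \<Longrightarrow> y \<in> S - A \<Longrightarrow> \<not> E x y"
      unfolding connected_rel_def by blast
    have "A \<union> (S - A) = S" using A by blast
    then have "\<not> colourable n A \<or> \<not> colourable n (S - A)"
      using colourable_disjoint_union[of n A "S - A"] no_edge psubset.prems by auto
    then obtain B where B: "B = A \<or> B = S - A" "\<not> colourable n B" by blast
    then have "B \<subset> S" using A by blast
    then obtain C where C: "C \<subseteq> B" "connected_rel E C" "\<not> colourable n C"
      "\<forall>x\<in>C. \<forall>y\<in>B - C. \<not> E x y" using psubset.IH[OF \<open>B \<subset> S\<close> B(2)] by metis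
    \<comment> \<open>No edge joins the chosen side to the other one, so a set without edges to the
      rest of \<open>B\<close> has none to the rest of \<open>S\<close>.\<close>
    have "\<not> E x y" if "x \<in> B" "y \<in> S - B" for x y
    proof (cases "B = A")
      case True
      then show ?thesis using no_edge that by blast
    next
      case False
      then have "x \<in> S - A" "y \<in> A" using B(1) that by auto
      then show ?thesis using no_edge sympD[OF symp] by blast
    qed
    then have "\<forall>x\<in>C. \<forall>y\<in>S - C. \<not> E x y" using C(1,4) by blast
    moreover have "C \<subseteq> S" using C(1) \<open>B \<subset> S\<close> by blast
    ultimately show ?thesis using C(2,3) by (intro exI[of _ C] conjI)
  qed
qed

section \<open>Greedy prolongation of induced paths\<close>

text \<open>Deleting the closed neighbourhood of \<open>v\<close> costs \<open>n + 1\<close> colours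
  and leaves a non-colourable component \<open>B\<close>. Some neighbour \<open>y\<close> of
  \<open>v\<close> has a neighbour in \<open>B\<close>, and the path goes on from \<open>y\<close>
  inside \<open>insert y B\<close>. The vertices after \<open>y\<close> lie in \<open>B\<close>, so
  none of them is adjacent to \<open>v\<close>.\<close>

lemma induced_path_from:
  assumes nbh: "\<And>v. v \<in> S \<Longrightarrow> colourable n {x \<in> S. E v x}"
    and "finite S" "C \<subseteq> S" "connected_rel E C" "v \<in> C" "\<not> colourable ((n + 1) * s) C"
  shows "\<exists>xs. induced_path E (v # xs) \<and> length xs = s \<and> set xs \<subseteq> C"
  using assms(3-)
proof (induction s arbitrary: v C)
  case 0
  then show ?case by auto
next
  case (Suc s)
  \<comment> \<open>The closed neighbourhood within \<open>C\<close>: \<open>n\<close> colours for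
    the neighbours and one more for \<open>v\<close> itself.\<close>
  let ?N = "insert v {x \<in> C. E v x}"
  have "colourable n {x \<in> C. E v x}"
    by (rule colourable_subset[OF nbh[of v]]) (use Suc.prems in auto)
  then have N: "colourable (1 + n) ?N"
    using colourable_Un[OF colourable_singleton] by (metis insert_is_Un)
  have "\<not> colourable ((n + 1) * s) (C - ?N)"
  proof
    assume "colourable ((n + 1) * s) (C - ?N)"
    from colourable_Un[OF N this] have "colourable ((n + 1) * Suc s) (?N \<union> (C - ?N))"
      by (simp add: algebra_simps)
    moreover have "C \<subseteq> ?N \<union> (C - ?N)" by auto
    ultimately show False using Suc.prems(4) colourable_subset by metis
  qed
  moreover have "finite (C - ?N)" using Suc.prems(1) assms(2) finite_subset by blast
  ultimately have "\<exists>B\<subseteq>C - ?N. connected_rel E B \<and> \<not> colourable ((n + 1) * s) B \<and>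
      (\<forall>x\<in>B. \<forall>y\<in>C - ?N - B. \<not> E x y)"
    by (intro non_colourable_component)
  then obtain B where B: "B \<subseteq> C - ?N" "connected_rel E B" "\<not> colourable ((n + 1) * s) B"
    "\<forall>x\<in>B. \<forall>y\<in>C - ?N - B. \<not> E x y"
    by (elim exE conjE) (rule that)
  have "B \<noteq> {}" using B(3) colourable_empty by metis
  moreover have "B \<subseteq> C" "B \<noteq> C" using B(1) Suc.prems(3) by auto
  \<comment> \<open>Some edge leaves \<open>B\<close> within the connected set \<open>C\<close>. As
    \<open>B\<close> is a component of \<open>C - ?N\<close>, its outer end \<open>y\<close> must
    lie in \<open>?N\<close>.\<close>
  ultimately obtain x y where xy: "x \<in> B" "y \<in> C - B" "E x y"
    using Suc.prems(2) unfolding connected_rel_def by blast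
  have "\<not> E v x" using xy B(1) by auto
  then have "y \<noteq> v" using xy(3) symp by (auto dest: sympD)
  moreover have "y \<in> ?N" using B(4) xy by blast
  ultimately have vy: "E v y" by simp
  have "\<not> colourable ((n + 1) * s) (insert y B)"
    using B(3) by (metis colourable_subset subset_insertI)
  moreover have "connected_rel E (insert y B)"
    using connected_rel_insert[OF B(2) xy(1,3) symp] .
  moreover have "insert y B \<subseteq> S" using xy B Suc.prems(1) by blast
  ultimately obtain xs where xs: "induced_path E (y # xs)" "length xs = s" "set xs \<subseteq> insert y B"
    using Suc.IH[of "insert y B" y] by blast
  \<comment> \<open>Within \<open>insert y B\<close> only \<open>y\<close> is adjacent to
    \<open>v\<close>, and distinctness keeps \<open>xs\<close> away from it.\<close>
  have "y \<notin> set xs" using induced_path_distinct[OF xs(1)] by simp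
  then have "set xs \<subseteq> B" using xs(3) by blast
  then have "v \<notin> set xs" "\<forall>z\<in>set xs. \<not> E v z" using B(1) by auto
  then have "induced_path E (v # y # xs)" using vy xs(1) \<open>y \<noteq> v\<close> by simp
  moreover have "set (y # xs) \<subseteq> C" using \<open>set xs \<subseteq> B\<close> \<open>B \<subseteq> C\<close> xy(2) by auto
  ultimately show ?case using xs(2) by (intro exI[of _ "y # xs"]) auto
qed

text \<open>Otherwise some component would not be colourable either, and the construction would give
  an induced path on \<open>t + 1\<close> vertices in it.\<close>

lemma colourable_if_long_path_free:
  assumes "\<And>v. v \<in> S \<Longrightarrow> colourable n {x \<in> S. E v x}" "finite S" "long_path_free t E S"
  shows "colourable ((n + 1) * t) S"
proof (rule ccontr)
  assume "\<not> colourable ((n + 1) * t) S"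
  then obtain C where C: "C \<subseteq> S" "connected_rel E C" "\<not> colourable ((n + 1) * t) C"
    using non_colourable_component[OF assms(2)] by metis
  have "C \<noteq> {}" using C(3) colourable_empty by metis
  then obtain v where v: "v \<in> C" by blast
  obtain xs where "induced_path E (v # xs)" "length xs = t" "set xs \<subseteq> C"
    using induced_path_from[OF assms(1,2) C(1,2) v C(3)] by metis
  moreover have "set (v # xs) \<subseteq> S" if "set xs \<subseteq> C" using that C(1) v by auto
  ultimately show False using assms(3) unfolding long_path_free_def
    by (metis le_Suc_eq length_Cons order.refl)
qed

end

lemma union_closed_class_alternating_cograph:
  assumes "symp E" "irreflp E"
  shows "union_closed_class E (alternating_cograph (Suc h) E)"
proof
  show "symp E" "irreflp E" by fact+
  show "alternating_cograph (Suc h) E A \<Longrightarrow> B \<subseteq> A \<Longrightarrow> alternating_cograph (Suc h) E B" for A B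
    by (rule alternating_cograph_subset)
  show "alternating_cograph (Suc h) E {v}" for v
    by (rule alternating_cograph_singleton)
  show "alternating_cograph (Suc h) E (A \<union> B)"
    if "alternating_cograph (Suc h) E A" "alternating_cograph (Suc h) E B" "A \<inter> B = {}"
      "\<And>x y. x \<in> A \<Longrightarrow> y \<in> B \<Longrightarrow> \<not> E x y" for A B
    using alternating_cograph_disjoint_union[OF that(1,2) assms(1) that(4,3)] .
qed


subsection \<open>Threshold graphs\<close>

text \<open>The steps are undone from the last one: \<open>v\<close> dominates the remaining
  vertices, which are then examined in the complement, so that the next vertex found is isolated
  from the rest, and so on.\<close>

fun has_threshold :: "nat \<Rightarrow> ('a \<Rightarrow> 'a \<Rightarrow> bool) \<Rightarrow> 'a set \<Rightarrow> bool" where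
  "has_threshold 0 E S \<longleftrightarrow> True"
| "has_threshold (Suc m) E S \<longleftrightarrow> (\<exists>v\<in>S. has_threshold m (compl_rel E) {x \<in> S. E v x})"

text \<open>A copy of \<open>R_k\<close> given by two sequences. Distinctness of the
  \<open>a i\<close> follows from their adjacencies when \<open>E\<close> is irreflexive, whereas
  for the \<open>b i\<close> it has to be stated.\<close>

definition universal_pattern ::
  "('a \<Rightarrow> 'a \<Rightarrow> bool) \<Rightarrow> nat \<Rightarrow> (nat \<Rightarrow> 'a) \<Rightarrow> (nat \<Rightarrow> 'a) \<Rightarrow> bool" where
  "universal_pattern E k a b \<longleftrightarrow>
     (\<forall>i\<in>{1..k}. \<forall>j\<in>{1..k}. (E (a i) (a j) \<longleftrightarrow> i \<noteq> j) \<and> (E (a i) (b j) \<longleftrightarrow> i \<le> j) \<and>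
        \<not> E (b i) (b j) \<and> a i \<noteq> b j \<and> (b i = b j \<longrightarrow> i = j))"

text \<open>Two unfoldings give \<open>v\<close>, adjacent to all that remains, and
  \<open>w\<close>, adjacent to \<open>v\<close> only. They become \<open>a\<^sub>1\<close> and
  \<open>b\<^sub>1\<close>, the other indices move up by one, and the two complements
  cancel.\<close>

lemma has_threshold_imp_universal:
  assumes "has_threshold (2 * k) E S" "symp E" "irreflp E"
  shows "\<exists>a b. a ` {1..k} \<subseteq> S \<and> b ` {1..k} \<subseteq> S \<and> universal_pattern E k a b"
  using assms(1)
proof (induction k arbitrary: S)
  case (Suc k)
  have double: "2 * Suc k = Suc (Suc (2 * k))" by simp
  have "\<exists>v\<in>S. \<exists>w\<in>{x \<in> S. E v x}.
      has_threshold (2 * k) E {y \<in> {x \<in> S. E v x}. compl_rel E w y}"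
    using Suc.prems
    unfolding double has_threshold.simps compl_rel_compl_rel[OF assms(3)] .
  then obtain v w where v: "v \<in> S" and w: "w \<in> S" "E v w"
    and thr: "has_threshold (2 * k) E {y \<in> {x \<in> S. E v x}. compl_rel E w y}"
    by (elim bexE CollectE conjE) (rule that)
  let ?S = "{y \<in> {x \<in> S. E v x}. compl_rel E w y}"
  obtain a b where sub: "a ` {1..k} \<subseteq> ?S" "b ` {1..k} \<subseteq> ?S"
    and pat: "universal_pattern E k a b"
    using Suc.IH[OF thr] by (elim exE conjE) (rule that)
  have ab: "a i \<in> S \<and> b i \<in> S \<and> E v (a i) \<and> E v (b i) \<and>
      \<not> E w (a i) \<and> \<not> E w (b i) \<and> w \<noteq> a i \<and> w \<noteq> b i" if "i \<in> {1..k}" for i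
    using subsetD[OF sub(1) imageI[OF that]] subsetD[OF sub(2) imageI[OF that]]
    by (simp add: compl_rel_def)
  have adj: "(E (a i) (a j) \<longleftrightarrow> i \<noteq> j) \<and> (E (a i) (b j) \<longleftrightarrow> i \<le> j) \<and>
      \<not> E (b i) (b j) \<and> a i \<noteq> b j \<and> (b i = b j \<longrightarrow> i = j)"
    if "i \<in> {1..k}" "j \<in> {1..k}" for i j
    using pat that unfolding universal_pattern_def by metis
  have sym: "E x y \<longleftrightarrow> E y x" for x y using assms(2) by (auto dest: sympD)
  have irr: "\<not> E x x" for x using assms(3) by (auto simp: irreflp_def)
  define a' where "a' i = (if i = 1 then v else a (i - 1))" for i
  define b' where "b' i = (if i = 1 then w else b (i - 1))" for i
  have pre: "i - 1 \<in> {1..k}" if "i \<in> {1..Suc k}" "i \<noteq> 1" for i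
    using that by auto
  have "a' i \<in> S \<and> b' i \<in> S" if "i \<in> {1..Suc k}" for i
    using ab[OF pre[OF that]] v w(1) by (cases "i = 1") (simp_all add: a'_def b'_def)
  then have "a' ` {1..Suc k} \<subseteq> S" "b' ` {1..Suc k} \<subseteq> S" by auto
  moreover have "(E (a' i) (a' j) \<longleftrightarrow> i \<noteq> j) \<and> (E (a' i) (b' j) \<longleftrightarrow> i \<le> j) \<and>
      \<not> E (b' i) (b' j) \<and> a' i \<noteq> b' j \<and> (b' i = b' j \<longrightarrow> i = j)"
    if i: "i \<in> {1..Suc k}" and j: "j \<in> {1..Suc k}" for i j
  proof -
    consider "i = 1" "j = 1" | "i = 1" "j \<noteq> 1" | "i \<noteq> 1" "j = 1" | "i \<noteq> 1" "j \<noteq> 1" by blast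
    then show ?thesis
    proof cases
      case 1
      then show ?thesis using w(2) irr by (auto simp: a'_def b'_def)
    next
      case 2
      then show ?thesis using ab[OF pre[OF j]] irr j by (auto simp: a'_def b'_def)
    next
      case 3
      then show ?thesis using ab[OF pre[OF i]] irr i sym by (auto simp: a'_def b'_def)
    next
      case 4
      \<comment> \<open>Truncated subtraction is safe here, since both indices exceed 1.\<close>
      then have "i - 1 = j - 1 \<longleftrightarrow> i = j" "i - 1 \<le> j - 1 \<longleftrightarrow> i \<le> j" using i j by auto
      with 4 show ?thesis using adj[OF pre[OF i] pre[OF j]] by (simp add: a'_def b'_def)
    qed
  qed
  ultimately show ?case unfolding universal_pattern_def by metis
qed (auto simp: universal_pattern_def)

lemma no_threshold_if_excludes:
  assumes "pair_graph G" "excludes_induced G (universal_threshold_graph k)"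
  shows "\<not> has_threshold (2 * k) (\<lambda>x y. (x, y) \<in> parcs G) (pverts G)"
proof
  assume "has_threshold (2 * k) (\<lambda>x y. (x, y) \<in> parcs G) (pverts G)"
  moreover note E = pair_graph_rel[OF assms(1)]
  ultimately obtain a b where mem: "a ` {1..k} \<subseteq> pverts G" "b ` {1..k} \<subseteq> pverts G"
    and pat: "universal_pattern (\<lambda>x y. (x, y) \<in> parcs G) k a b"
    using has_threshold_imp_universal by blast
  have adj: "((a i, a j) \<in> parcs G \<longleftrightarrow> i \<noteq> j) \<and> ((a i, b j) \<in> parcs G \<longleftrightarrow> i \<le> j) \<and>
      (b i, b j) \<notin> parcs G \<and> a i \<noteq> b j \<and> (b i = b j \<longrightarrow> i = j)"
    if "i \<in> {1..k}" "j \<in> {1..k}" for i j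
    using pat that unfolding universal_pattern_def by metis
  \<comment> \<open>Mixed arcs are listed in both orientations, so that all four combinations of
    \<open>Inl\<close> and \<open>Inr\<close> below are decided by rewriting.\<close>
  have arcs: "(a i, a j) \<in> parcs G \<longleftrightarrow> i \<noteq> j" "(a i, b j) \<in> parcs G \<longleftrightarrow> i \<le> j"
    "(b j, a i) \<in> parcs G \<longleftrightarrow> i \<le> j" "(b i, b j) \<notin> parcs G"
    if "i \<in> {1..k}" "j \<in> {1..k}" for i j
    using adj[OF that] sympD[OF E(1), of "a i" "b j"] sympD[OF E(1), of "b j" "a i"] by blast+
  have eqs: "a i = a j \<longleftrightarrow> i = j" "b i = b j \<longleftrightarrow> i = j" "a i \<noteq> b j" "b j \<noteq> a i"
    if "i \<in> {1..k}" "j \<in> {1..k}" for i j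
    using adj[OF that] irreflpD[OF E(2), of "a j"] by metis+
  let ?f = "case_sum a b" and ?H = "universal_threshold_graph k"
  have V: "pverts ?H = Inl ` {1..k} \<union> Inr ` {1..k}"
    by (simp add: universal_threshold_graph_def)
  have "inj_on ?f (pverts ?H)"
    unfolding V
  proof (rule inj_onI)
    fix x y assume "x \<in> Inl ` {1..k} \<union> Inr ` {1..k}" "y \<in> Inl ` {1..k} \<union> Inr ` {1..k}" "?f x = ?f y"
    then show "x = y"
      by (elim UnE imageE) (simp_all add: eqs)
  qed
  moreover have "?f ` pverts ?H \<subseteq> pverts G" using mem unfolding V by auto
  moreover have "(u, v) \<in> parcs ?H \<longleftrightarrow> (?f u, ?f v) \<in> parcs G"
    if "u \<in> pverts ?H" "v \<in> pverts ?H" for u v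
    using that unfolding V
    by (elim UnE imageE) (auto simp: universal_threshold_graph_def arcs)
  ultimately show False
    using assms(2) unfolding excludes_induced_iff[OF pair_graph_universal_threshold_graph] by blast
qed

section \<open>Induction on the number of steps\<close>

text \<open>The bound depends on \<open>t\<close> and \<open>m\<close> only, not on the graph. For
  \<open>m = 0\<close> the last hypothesis is false. For \<open>Suc m\<close> every neighbourhood
  satisfies the hypotheses for \<open>m\<close> in the complement, which bounds the colours it
  needs.\<close>

lemma colourable_if_no_threshold:
  "\<exists>N. \<forall>(E :: 'a \<Rightarrow> 'a \<Rightarrow> bool) S. symp E \<longrightarrow> irreflp E \<longrightarrow> finite S \<longrightarrow>
     long_path_free t E S \<longrightarrow> long_path_free t (compl_rel E) S \<longrightarrow> \<not> has_threshold m E S \<longrightarrow>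
     class_colourable (alternating_cograph m E) N S"
proof (induction m)
  case (Suc m)
  then obtain N where N: "\<And>(E :: 'a \<Rightarrow> 'a \<Rightarrow> bool) S. symp E \<Longrightarrow> irreflp E \<Longrightarrow> finite S \<Longrightarrow>
     long_path_free t E S \<Longrightarrow> long_path_free t (compl_rel E) S \<Longrightarrow> \<not> has_threshold m E S \<Longrightarrow>
     class_colourable (alternating_cograph m E) N S" by blast
  show ?case
  proof (intro exI allI impI)
    fix E :: "'a \<Rightarrow> 'a \<Rightarrow> bool" and S
    assume E: "symp E" "irreflp E" and S: "finite S" "long_path_free t E S"
      "long_path_free t (compl_rel E) S" "\<not> has_threshold (Suc m) E S"
    interpret union_closed_class E "alternating_cograph (Suc m) E"
      by (rule union_closed_class_alternating_cograph[OF E])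
    show "class_colourable (alternating_cograph (Suc m) E) ((N + 1) * t) S"
    proof (rule colourable_if_long_path_free)
      fix v assume "v \<in> S"
      let ?S = "{x \<in> S. E v x}"
      have "finite ?S" using S(1) by simp
      \<comment> \<open>In the complement the two conditions on paths merely change places.\<close>
      moreover have "long_path_free t (compl_rel E) ?S"
        by (rule long_path_free_subset[OF S(3)]) auto
      moreover have "long_path_free t (compl_rel (compl_rel E)) ?S"
        unfolding compl_rel_compl_rel[OF E(2)] by (rule long_path_free_subset[OF S(2)]) auto
      moreover have "\<not> has_threshold m (compl_rel E) ?S"
        using S(4) \<open>v \<in> S\<close> by auto
      ultimately have "class_colourable (alternating_cograph m (compl_rel E)) N ?S"
        using N symp_compl_rel[OF E(1)] irreflp_compl_rel by metis
      \<comment> \<open>The one level of height that each step costs is spent here, on returning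
        from the complement to \<open>E\<close>.\<close>
      then show "class_colourable (alternating_cograph (Suc m) E) N {x \<in> S. E v x}"
        by (rule class_colourable_mono) (rule alternating_cograph_Suc_compl)
    qed (use S in auto)
  qed
qed simp

theorem theorem1p8:
  fixes t k :: nat
  shows "\<exists>N::nat. \<forall>G :: 'a pair_pre_digraph.
           pair_graph G \<and>
           excludes_induced G (path_graph t) \<and>
           excludes_induced G (complement_graph (path_graph t)) \<and>
           excludes_induced G (universal_threshold_graph k) \<longrightarrow>
           (\<exists>P. cosplit G P \<and> card P \<le> N \<and> cosplit_height_at_most (4 * k) G P)"
proof -
  \<comment> \<open>\<open>R_k\<close> takes \<open>2 * k\<close> steps, one for each
    vertex.\<close>
  obtain N where N: "\<And>(E :: 'a \<Rightarrow> 'a \<Rightarrow> bool) S. symp E \<Longrightarrow> irreflp E \<Longrightarrow> finite S \<Longrightarrow>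
     long_path_free t E S \<Longrightarrow> long_path_free t (compl_rel E) S \<Longrightarrow> \<not> has_threshold (2 * k) E S \<Longrightarrow>
     class_colourable (alternating_cograph (2 * k) E) N S"
    using colourable_if_no_threshold[of t "2 * k"] by blast
  show ?thesis
  proof (intro exI[of _ N] allI impI, elim conjE)
    fix G :: "'a pair_pre_digraph"
    assume G: "pair_graph G" and P: "excludes_induced G (path_graph t)"
      and coP: "excludes_induced G (complement_graph (path_graph t))"
      and R: "excludes_induced G (universal_threshold_graph k)"
    interpret pair_graph G by fact
    let ?E = "\<lambda>x y. (x, y) \<in> parcs G" and ?V = "pverts G"
    note E = pair_graph_rel[OF G]
    have "long_path_free t (\<lambda>x y. (x, y) \<in> parcs (complement_graph G)) ?V"
      using long_path_free_if_excludes[OF pair_graph_complement_graph[OF G]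
          excludes_induced_complement[OF G pair_graph_path_graph coP]]
      by (simp add: complement_graph_def)
    \<comment> \<open>\<open>compl_rel\<close> also relates elements outside the vertex set, but the
      two complements agree on lists of vertices.\<close>
    moreover have "induced_path (\<lambda>x y. (x, y) \<in> parcs (complement_graph G)) xs"
      if "induced_path (compl_rel ?E) xs" "set xs \<subseteq> ?V" for xs
      using that
      by (induction "compl_rel ?E" xs rule: induced_path.induct)
        (auto simp: complement_graph_def compl_rel_def)
    ultimately have "long_path_free t (compl_rel ?E) ?V"
      unfolding long_path_free_def by blast
    with N[OF E pair_finite_verts long_path_free_if_excludes[OF G P]]
      no_threshold_if_excludes[OF G R]
    obtain c :: "'a \<Rightarrow> nat" where c: "\<forall>x\<in>?V. c x < N"
      "\<And>i. alternating_cograph (2 * k) ?E {x \<in> ?V. c x = i}"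
      by (auto simp: class_colourable_def)
    \<comment> \<open>Only colours that occur give parts, since neither a partition nor a cotree
      allows an empty one.\<close>
    define P where "P = (\<lambda>i. {x \<in> ?V. c x = i}) ` c ` ?V"
    have "c ` ?V \<subseteq> {..<N}" using c(1) by auto
    then have "card (c ` ?V) \<le> N" using card_mono[of "{..<N}"] by fastforce
    then have card: "card P \<le> N"
      unfolding P_def using pair_finite_verts by (meson card_image_le finite_imageI order.trans)
    \<comment> \<open>The cotrees obtained have height \<open>2 * k\<close>, which is at most
      \<open>4 * k\<close>.\<close>
    have height: "cograph_of_height_at_most (4 * k) (with_proj G \<restriction> A)" if "A \<in> P" for A
      using that pair_finite_verts
      by (intro cograph_of_height_at_mostI[of "2 * k"] G) (auto simp: P_def c(2))
    moreover have "partition_on ?V P"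
      by (rule partition_onI) (auto simp: P_def disjnt_def)
    ultimately have "cosplit G P"
      unfolding cosplit_def cograph_def by blast
    with card height show "\<exists>P. cosplit G P \<and> card P \<le> N \<and> cosplit_height_at_most (4 * k) G P"
      unfolding cosplit_height_at_most_def by blast
  qed
qed

end
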